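(* Let $\alpha>0$ and $\epsilon>0$ be fixed, $J_n=n^{-(1+\alpha)}$ for $n\ge1$, $J=\zeta(1+\alpha)$. For $\omega_A,\omega_B>0$ define $$q_0=\sqrt{\omega_A+2\epsilon J},\qquad q_n=\frac{\epsilon\left(J_nq_0+\sum_{m=1}^{n-1}(J_{n-m}+J_{n+m})q_m\right)}{\epsilon(2J-J_{2n})+\omega_A}\quad(n\ge1),\qquad q_{-n}=q_n,$$ $$g_1=g_0=\sqrt{\omega_B+\epsilon(2J-J_1)},\qquad g_n=\frac{\epsilon\sum_{m=1}^{n-1}(J_{n-m}+J_{n+m-1})g_m}{\epsilon(2J-J_{2n-1})+\omega_B}\quad(n\ge2),\qquad g_n=g_{-(n-1)},$$ and $E_A=E_A(\omega_A)=E[q]$, $E_B=E_B(\omega_B)=E[g]$, where $E[u]=\frac\epsilon4\sum_{n\ne m}\frac{|u_n-u_m|^2}{|n-m|^{1+\alpha}}-\frac14\sum_{n\in\mathbb{Z}}|u_n|^4$. Assume $\omega_A=2\omega_B$. Then as $\omega_A,\omega_B\to\infty$, $$E_A\sim-\frac{\omega_A^2}4-\left(2\zeta(2+2\alpha)+\zeta(1+\alpha)^2\right)\epsilon^2,$$ $$E_B\sim-\frac{\omega_B^2}2-\left(2\sum_{n=2}^\infty\left(\frac1{n^{1+\alpha}}+\frac1{(n-1)^{1+\alpha}}\right)^2+\frac12(2\zeta(1+\alpha)-1)^2\right)\epsilon^2 .$$ Therefore $E_A(\omega_A)\sim2E_B(\omega_B)$ and $\Delta E_{AB}:=E_A(\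omega_A)-E_B(\omega_B)\sim-\dfrac{\omega_A^2}8$.
   Context: $a\sim b$ means $a/b\to1$ in the stated limit. In $E[u]$ the double sum is over ordered pairs $(n,m)\in\mathbb{Z}^2$, $n\ne m$. $\zeta$ is the Riemann zeta function. The quantity $\Delta E_{AB}$ is called the Peierls–Nabarro barrier; the relation $\omega_A=2\omega_B$ is the paper's convention reflecting equal power of the two modes. *)

theory Defs
  imports "HOL-Analysis.Analysis" "HOL-Library.Landau_Symbols"
begin

(* The Riemann zeta function at real s > 1, where the series converges. *)
definition zeta :: "real \<Rightarrow> real" where
  "zeta s = (\<Sum>\<^sub>\<infinity>n\<in>{1::nat..}. 1 / real n powr s)"

(* Only used for n \<ge> 1; the value at n = 0 is 0. *)
definition J :: "real \<Rightarrow> nat \<Rightarrow> real" where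
  "J \<alpha> n = real n powr (- (1 + \<alpha>))"

(* The values for n \<ge> 0 of the on-site sequence. *)
function qseq :: "real \<Rightarrow> real \<Rightarrow> real \<Rightarrow> nat \<Rightarrow> real" where
  "qseq \<alpha> \<epsilon> \<omega> n =
     (if n = 0 then sqrt (\<omega> + 2 * \<epsilon> * zeta (1 + \<alpha>))
      else \<epsilon> * (J \<alpha> n * qseq \<alpha> \<epsilon> \<omega> 0
                + (\<Sum>m\<in>{1..<n}. (J \<alpha> (n - m) + J \<alpha> (n + m)) * qseq \<alpha> \<epsilon> \<omega> m))
           / (\<epsilon> * (2 * zeta (1 + \<alpha>) - J \<alpha> (2 * n)) + \<omega>))"
  by pat_completeness auto
termination by (relation "Wellfounded.measure (\<lambda>(\<alpha>, \<epsilon>, \<omega>, n). n)") auto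

(* The values for n \<ge> 1 of the inter-site sequence; n = 0 is sent to the same value
   as n = 1, as required by the symmetry about the bond between sites 0 and 1. *)
function gseq :: "real \<Rightarrow> real \<Rightarrow> real \<Rightarrow> nat \<Rightarrow> real" where
  "gseq \<alpha> \<epsilon> \<omega> n =
     (if n \<le> 1 then sqrt (\<omega> + \<epsilon> * (2 * zeta (1 + \<alpha>) - J \<alpha> 1))
      else \<epsilon> * (\<Sum>m\<in>{1..<n}. (J \<alpha> (n - m) + J \<alpha> (n + m - 1)) * gseq \<alpha> \<epsilon> \<omega> m)
           / (\<epsilon> * (2 * zeta (1 + \<alpha>) - J \<alpha> (2 * n - 1)) + \<omega>))"
  by pat_completeness auto
termination by (relation "Wellfounded.measure (\<lambda>(\<alpha>, \<epsilon>, \<omega>, n). n)") auto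

declare qseq.simps [simp del] gseq.simps [simp del]

definition qmode :: "real \<Rightarrow> real \<Rightarrow> real \<Rightarrow> int \<Rightarrow> real" where
  "qmode \<alpha> \<epsilon> \<omega> n = qseq \<alpha> \<epsilon> \<omega> (nat \<bar>n\<bar>)"

definition gmode :: "real \<Rightarrow> real \<Rightarrow> real \<Rightarrow> int \<Rightarrow> real" where
  "gmode \<alpha> \<epsilon> \<omega> n = (if n \<ge> 1 then gseq \<alpha> \<epsilon> \<omega> (nat n) else gseq \<alpha> \<epsilon> \<omega> (nat (1 - n)))"

(* Both sums are unconditional sums of nonnegative terms; infsum would give 0 on divergence,
   but qmode_energy_summable and gmode_energy_summable below show that this does not
   happen for the two sequences considered. *)
definition energy :: "real \<Rightarrow> real \<Rightarrow> (int \<Rightarrow> real) \<Rightarrow> real" where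
  "energy \<alpha> \<epsilon> u =
     \<epsilon> / 4 * (\<Sum>\<^sub>\<infinity>(n, m)\<in>{(n, m). n \<noteq> m}. \<bar>u n - u m\<bar>\<^sup>2 / real_of_int \<bar>n - m\<bar> powr (1 + \<alpha>))
     - 1 / 4 * (\<Sum>\<^sub>\<infinity>n. \<bar>u n\<bar> ^ 4)"

definition E_A :: "real \<Rightarrow> real \<Rightarrow> real \<Rightarrow> real" where
  "E_A \<alpha> \<epsilon> \<omega> = energy \<alpha> \<epsilon> (qmode \<alpha> \<epsilon> \<omega>)"

definition E_B :: "real \<Rightarrow> real \<Rightarrow> real \<Rightarrow> real" where
  "E_B \<alpha> \<epsilon> \<omega> = energy \<alpha> \<epsilon> (gmode \<alpha> \<epsilon> \<omega>)"

lemma J_nonneg: "0 \<le> J \<alpha> n"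
  by (simp add: J_def)

lemma J_zero [simp]: "J \<alpha> 0 = 0"
  by (simp add: J_def)

lemma J_antimono: "0 < \<alpha> \<Longrightarrow> 1 \<le> m \<Longrightarrow> m \<le> n \<Longrightarrow> J \<alpha> n \<le> J \<alpha> m"
  unfolding J_def by (intro powr_mono2') auto

lemma J_summable: "0 < \<alpha> \<Longrightarrow> J \<alpha> summable_on A"
proof -
  assume a: "0 < \<alpha>"
  have "summable (\<lambda>n. real n powr (- (1 + \<alpha>)))"
    using a by (subst summable_real_powr_iff) auto
  then have "J \<alpha> summable_on UNIV"
    unfolding J_def[abs_def] by (subst summable_on_UNIV_nonneg_real_iff) auto
  then show ?thesis
    using summable_on_subset_banach by blast
qed

lemma zeta_eq: "zeta (1 + \<alpha>) = infsum (J \<alpha>) UNIV"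
  unfolding zeta_def J_def
  by (rule infsum_cong_neutral) (auto simp: powr_minus_divide[of _ "1 + \<alpha>", simplified] not_less_eq_eq)

lemma sum_J_le: "0 < \<alpha> \<Longrightarrow> finite A \<Longrightarrow> sum (J \<alpha>) A \<le> zeta (1 + \<alpha>)"
  unfolding zeta_eq by (rule finite_sum_le_infsum) (auto simp: J_summable J_nonneg)

lemma sum_J_le':
  assumes "0 < \<alpha>" "finite A" "k \<notin> A"
  shows "sum (J \<alpha>) A \<le> zeta (1 + \<alpha>) - J \<alpha> k"
  using sum_J_le[of \<alpha> "insert k A"] assms by simp

lemma J_le_zeta: "0 < \<alpha> \<Longrightarrow> J \<alpha> n \<le> zeta (1 + \<alpha>)"
  using sum_J_le[of \<alpha> "{n}"] by simp

lemma causal_partial_sum_bound: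
  fixes x b :: "nat \<Rightarrow> real"
  assumes step: "\<And>n. n \<in> {1..N} \<Longrightarrow> D * x n \<le> b n + (\<Sum>m\<in>{1..<n}. K n m * x m)"
    and col: "\<And>m. m \<in> {1..N} \<Longrightarrow> (\<Sum>n\<in>{m<..N}. K n m) \<le> D - w"
    and nonneg: "\<And>m. 0 \<le> x m"
    and b: "(\<Sum>n\<in>{1..N}. b n) \<le> B"
  shows "w * (\<Sum>n\<in>{1..N}. x n) \<le> B"
proof -
  have "D * (\<Sum>n\<in>{1..N}. x n) \<le> (\<Sum>n\<in>{1..N}. b n + (\<Sum>m\<in>{1..<n}. K n m * x m))"
    unfolding sum_distrib_left by (rule sum_mono) (rule step)
  also have "\<dots> = (\<Sum>n\<in>{1..N}. b n) + (\<Sum>n\<in>{1..N}. \<Sum>m\<in>{1..<n}. K n m * x m)"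
    by (simp add: sum.distrib)
  also have "(\<Sum>n\<in>{1..N}. \<Sum>m\<in>{1..<n}. K n m * x m) = (\<Sum>m\<in>{1..N}. \<Sum>n\<in>{m<..N}. K n m * x m)"
    unfolding sum.Sigma[OF finite_atLeastAtMost ballI[OF finite_atLeastLessThan]]
      sum.Sigma[OF finite_atLeastAtMost ballI[OF finite_greaterThanAtMost]]
    by (rule sum.reindex_bij_witness[of _ "\<lambda>(m, n). (n, m)" "\<lambda>(n, m). (m, n)"]) auto
  also have "\<dots> = (\<Sum>m\<in>{1..N}. (\<Sum>n\<in>{m<..N}. K n m) * x m)"
    by (simp add: sum_distrib_right)
  also have "\<dots> \<le> (\<Sum>m\<in>{1..N}. (D - w) * x m)"
    by (intro sum_mono mult_right_mono col nonneg) auto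
  also have "\<dots> = (D - w) * (\<Sum>m\<in>{1..N}. x m)"
    by (simp add: sum_distrib_left)
  finally show ?thesis
    using b by (simp add: algebra_simps)
qed

lemma summable_nat_from_bound:
  fixes x :: "nat \<Rightarrow> real"
  assumes "\<And>n. 0 \<le> x n" "0 < w" "\<And>N. w * (\<Sum>n\<in>{1..N}. x n) \<le> B"
  shows "x summable_on UNIV"
proof -
  have "summable x"
  proof (rule bounded_imp_summable)
    show "(\<Sum>n\<le>N. x n) \<le> x 0 + B / w" for N
    proof -
      have "(\<Sum>n\<le>N. x n) = x 0 + (\<Sum>n\<in>{1..N}. x n)"
        by (simp add: atMost_atLeast0 sum.atLeast_Suc_atMost)
      moreover have "(\<Sum>n\<in>{1..N}. x n) \<le> B / w"
        using assms(2) assms(3)[of N] by (simp add: field_simps)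
      ultimately show ?thesis by simp
    qed
  qed (use assms in auto)
  then show ?thesis
    by (subst summable_on_UNIV_nonneg_real_iff) (use assms in auto)
qed

lemma denom_pos:
  assumes "0 < \<alpha>" "0 < \<epsilon>" "0 < \<omega>"
  shows "0 < \<epsilon> * (2 * zeta (1 + \<alpha>) - J \<alpha> k) + \<omega>"
proof -
  have "0 \<le> 2 * zeta (1 + \<alpha>) - J \<alpha> k"
    using J_le_zeta[of \<alpha> k] J_nonneg[of \<alpha> k] assms by linarith
  then show ?thesis
    using assms by (simp add: add_nonneg_pos)
qed

lemma qseq_nonneg:
  assumes "0 < \<alpha>" "0 < \<epsilon>" "0 < \<omega>"
  shows "0 \<le> qseq \<alpha> \<epsilon> \<omega> n"
proof (induction n rule: less_induct)
  case (less n)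
  have "0 \<le> zeta (1 + \<alpha>)"
    using J_le_zeta[of \<alpha> 0] assms by simp
  then show ?case
    using less assms less_imp_le[OF denom_pos[OF assms, of "2 * n"]]
    by (subst qseq.simps)
       (auto intro!: divide_nonneg_nonneg mult_nonneg_nonneg add_nonneg_nonneg sum_nonneg J_nonneg)
qed

lemma gseq_nonneg:
  assumes "0 < \<alpha>" "0 < \<epsilon>" "0 < \<omega>"
  shows "0 \<le> gseq \<alpha> \<epsilon> \<omega> n"
proof (induction n rule: less_induct)
  case (less n)
  show ?case
    using less assms less_imp_le[OF denom_pos[OF assms, of "2 * n - 1"]]
      less_imp_le[OF denom_pos[OF assms, of 1]]
    by (subst gseq.simps)
       (auto simp: add.commute intro!: divide_nonneg_nonneg mult_nonneg_nonneg add_nonneg_nonneg sum_nonneg J_nonneg)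
qed

lemma qseq_summable:
  assumes "0 < \<alpha>" "0 < \<epsilon>" "0 < \<omega>"
  shows "qseq \<alpha> \<epsilon> \<omega> summable_on UNIV"
proof (rule summable_nat_from_bound)
  fix N
  let ?Z = "zeta (1 + \<alpha>)" and ?q = "qseq \<alpha> \<epsilon> \<omega>"
  show "\<omega> * (\<Sum>n\<in>{1..N}. ?q n) \<le> \<epsilon> * ?q 0 * ?Z"
  proof (rule causal_partial_sum_bound
      [where D = "\<epsilon> * (2 * ?Z - J \<alpha> 2) + \<omega>" and b = "\<lambda>n. \<epsilon> * ?q 0 * J \<alpha> n"
         and K = "\<lambda>n m. \<epsilon> * (J \<alpha> (n - m) + J \<alpha> (n + m))"])
    fix n assume n: "n \<in> {1..N}"
    have "(\<epsilon> * (2 * ?Z - J \<alpha> 2) + \<omega>) * ?q n \<le> (\<epsilon> * (2 * ?Z - J \<alpha> (2 * n)) + \<omega>) * ?q n"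
      using n assms J_antimono[of \<alpha> 2 "2 * n"]
      by (intro mult_right_mono qseq_nonneg) auto
    also have "\<dots> = \<epsilon> * (J \<alpha> n * ?q 0 + (\<Sum>m\<in>{1..<n}. (J \<alpha> (n - m) + J \<alpha> (n + m)) * ?q m))"
      using n denom_pos[OF assms, of "2 * n"] by (subst (1) qseq.simps) (simp add: field_simps)
    also have "\<dots> = \<epsilon> * ?q 0 * J \<alpha> n + (\<Sum>m\<in>{1..<n}. \<epsilon> * (J \<alpha> (n - m) + J \<alpha> (n + m)) * ?q m)"
      by (simp add: ring_distribs sum_distrib_left mult_ac)
    finally show "(\<epsilon> * (2 * ?Z - J \<alpha> 2) + \<omega>) * ?q n \<le> \<dots>" .
  next
    fix m assume m: "m \<in> {1..N}"
    have "(\<Sum>n\<in>{m<..N}. J \<alpha> (n - m)) = sum (J \<alpha>) ((\<lambda>n. n - m) ` {m<..N})"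
      by (subst sum.reindex) (auto simp: inj_on_def)
    also have "\<dots> \<le> ?Z"
      using assms by (intro sum_J_le) auto
    finally have 1: "(\<Sum>n\<in>{m<..N}. J \<alpha> (n - m)) \<le> ?Z" .
    have "(\<Sum>n\<in>{m<..N}. J \<alpha> (n + m)) = sum (J \<alpha>) ((\<lambda>n. n + m) ` {m<..N})"
      by (subst sum.reindex) (auto simp: inj_on_def)
    also have "\<dots> \<le> ?Z - J \<alpha> 2"
      using assms m by (intro sum_J_le') auto
    finally have 2: "(\<Sum>n\<in>{m<..N}. J \<alpha> (n + m)) \<le> ?Z - J \<alpha> 2" .
    have "(\<Sum>n\<in>{m<..N}. \<epsilon> * (J \<alpha> (n - m) + J \<alpha> (n + m)))
        = \<epsilon> * ((\<Sum>n\<in>{m<..N}. J \<alpha> (n - m)) + (\<Sum>n\<in>{m<..N}. J \<alpha> (n + m)))"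
      by (simp only: sum.distrib flip: sum_distrib_left)
    also have "\<dots> \<le> \<epsilon> * (?Z + (?Z - J \<alpha> 2))"
      using assms by (intro mult_left_mono add_mono 1 2) auto
    finally show "(\<Sum>n\<in>{m<..N}. \<epsilon> * (J \<alpha> (n - m) + J \<alpha> (n + m)))
        \<le> \<epsilon> * (2 * ?Z - J \<alpha> 2) + \<omega> - \<omega>"
      by (simp add: algebra_simps)
  next
    show "(\<Sum>n\<in>{1..N}. \<epsilon> * ?q 0 * J \<alpha> n) \<le> \<epsilon> * ?q 0 * ?Z"
      using assms unfolding sum_distrib_left[symmetric]
      by (intro mult_left_mono sum_J_le mult_nonneg_nonneg qseq_nonneg) auto
  qed (rule qseq_nonneg[OF assms])
qed (use assms qseq_nonneg in auto)

lemma gseq_summable: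
  assumes "0 < \<alpha>" "0 < \<epsilon>" "0 < \<omega>"
  shows "gseq \<alpha> \<epsilon> \<omega> summable_on UNIV"
proof (rule summable_nat_from_bound)
  fix N
  let ?Z = "zeta (1 + \<alpha>)" and ?g = "gseq \<alpha> \<epsilon> \<omega>"
  let ?D = "\<epsilon> * (2 * ?Z - J \<alpha> 1) + \<omega>"
  show "\<omega> * (\<Sum>n\<in>{1..N}. ?g n) \<le> ?D * ?g 1"
  proof (rule causal_partial_sum_bound
      [where D = ?D and b = "\<lambda>n. if n = 1 then ?D * ?g 1 else 0"
         and K = "\<lambda>n m. \<epsilon> * (J \<alpha> (n - m) + J \<alpha> (n + m - 1))"])
    fix n assume n: "n \<in> {1..N}"
    show "?D * ?g n \<le> (if n = 1 then ?D * ?g 1 else 0)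
        + (\<Sum>m\<in>{1..<n}. \<epsilon> * (J \<alpha> (n - m) + J \<alpha> (n + m - 1)) * ?g m)"
    proof (cases "n = 1")
      case False
      have "?D * ?g n \<le> (\<epsilon> * (2 * ?Z - J \<alpha> (2 * n - 1)) + \<omega>) * ?g n"
        using n assms J_antimono[of \<alpha> 1 "2 * n - 1"]
        by (intro mult_right_mono gseq_nonneg) auto
      also have "\<dots> = \<epsilon> * (\<Sum>m\<in>{1..<n}. (J \<alpha> (n - m) + J \<alpha> (n + m - 1)) * ?g m)"
        using n False denom_pos[OF assms, of "2 * n - 1"]
        by (subst (1) gseq.simps) (simp add: field_simps)
      also have "\<dots> = (\<Sum>m\<in>{1..<n}. \<epsilon> * (J \<alpha> (n - m) + J \<alpha> (n + m - 1)) * ?g m)"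
        by (simp add: sum_distrib_left mult_ac)
      finally show ?thesis using False by simp
    qed simp
  next
    fix m assume m: "m \<in> {1..N}"
    have "(\<Sum>n\<in>{m<..N}. J \<alpha> (n - m)) = sum (J \<alpha>) ((\<lambda>n. n - m) ` {m<..N})"
      by (subst sum.reindex) (auto simp: inj_on_def)
    also have "\<dots> \<le> ?Z"
      using assms by (intro sum_J_le) auto
    finally have 1: "(\<Sum>n\<in>{m<..N}. J \<alpha> (n - m)) \<le> ?Z" .
    have "(\<Sum>n\<in>{m<..N}. J \<alpha> (n + m - 1)) = sum (J \<alpha>) ((\<lambda>n. n + m - 1) ` {m<..N})"
      by (subst sum.reindex) (auto simp: inj_on_def)
    also have "\<dots> \<le> ?Z - J \<alpha> 1"
      using assms m by (intro sum_J_le') auto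
    finally have 2: "(\<Sum>n\<in>{m<..N}. J \<alpha> (n + m - 1)) \<le> ?Z - J \<alpha> 1" .
    have "(\<Sum>n\<in>{m<..N}. \<epsilon> * (J \<alpha> (n - m) + J \<alpha> (n + m - 1)))
        = \<epsilon> * ((\<Sum>n\<in>{m<..N}. J \<alpha> (n - m)) + (\<Sum>n\<in>{m<..N}. J \<alpha> (n + m - 1)))"
      by (simp only: sum.distrib flip: sum_distrib_left)
    also have "\<dots> \<le> \<epsilon> * (?Z + (?Z - J \<alpha> 1))"
      using assms by (intro mult_left_mono add_mono 1 2) auto
    finally show "(\<Sum>n\<in>{m<..N}. \<epsilon> * (J \<alpha> (n - m) + J \<alpha> (n + m - 1))) \<le> ?D - \<omega>"
      by (simp add: algebra_simps)
  next
    show "(\<Sum>n\<in>{1..N}. if n = 1 then ?D * ?g 1 else 0) \<le> ?D * ?g 1"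
      using denom_pos[OF assms, of 1] gseq_nonneg[OF assms, of 1]
      by (auto simp: sum.delta intro!: mult_nonneg_nonneg less_imp_le)
  qed (rule gseq_nonneg[OF assms])
qed (use assms gseq_nonneg in auto)

lemma summable_on_int_halves:
  fixes u :: "int \<Rightarrow> real" and x y :: "nat \<Rightarrow> real"
  assumes "x summable_on UNIV" "y summable_on UNIV"
    and "\<And>n. n \<ge> 1 \<Longrightarrow> u (int n) = x n" "\<And>n. u (- int n) = y n"
  shows "u summable_on UNIV"
proof -
  have "u summable_on int ` {1..}"
    using assms summable_on_subset_banach[of x UNIV "{1..}"]
    by (subst summable_on_reindex)
       (auto intro: summable_on_cong[THEN iffD1, of _ x] simp: o_def)
  moreover have "u summable_on (\<lambda>n. - int n) ` UNIV"
    using assms by (subst summable_on_reindex) (auto simp: o_def inj_on_def)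
  moreover have "int ` {1..} \<inter> (\<lambda>n. - int n) ` UNIV = {}"
    by auto
  moreover have "k \<in> int ` {1..} \<union> (\<lambda>n. - int n) ` UNIV" for k :: int
    by (cases "k \<ge> 1")
       (auto simp: image_iff intro: bexI[of _ "nat k"] exI[of _ "nat (- k)"])
  then have "int ` {1..} \<union> (\<lambda>n. - int n) ` UNIV = UNIV"
    by blast
  ultimately show ?thesis
    using summable_on_Un_disjoint by metis
qed

lemma qmode_summable:
  assumes "0 < \<alpha>" "0 < \<epsilon>" "0 < \<omega>"
  shows "qmode \<alpha> \<epsilon> \<omega> summable_on UNIV"
  by (rule summable_on_int_halves[OF qseq_summable[OF assms] qseq_summable[OF assms]])
     (auto simp: qmode_def)

lemma gmode_summable:
  assumes "0 < \<alpha>" "0 < \<epsilon>" "0 < \<omega>"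
  shows "gmode \<alpha> \<epsilon> \<omega> summable_on UNIV"
proof (rule summable_on_int_halves[OF gseq_summable[OF assms]])
  have "gseq \<alpha> \<epsilon> \<omega> summable_on range Suc"
    using gseq_summable[OF assms] summable_on_subset_banach by blast
  then show "(\<lambda>n. gseq \<alpha> \<epsilon> \<omega> (Suc n)) summable_on UNIV"
    by (subst (asm) summable_on_reindex) (auto simp: o_def)
qed (auto simp: gmode_def nat_add_distrib)

lemma energy_summable:
  fixes u :: "int \<Rightarrow> real"
  assumes \<alpha>: "0 < \<alpha>" and u: "u summable_on UNIV" and nonneg: "\<And>n. 0 \<le> u n"
  shows "(\<lambda>n. \<bar>u n\<bar> ^ 4) summable_on UNIV"
    and "(\<lambda>(n, m). \<bar>u n - u m\<bar>\<^sup>2 / real_of_int \<bar>n - m\<bar> powr (1 + \<alpha>)) summable_on {(n, m). n \<noteq> m}"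
proof -
  define B where "B = infsum u UNIV"
  have le: "u n \<le> B" for n
    using finite_sum_le_infsum[OF u, of "{n}"] nonneg by (auto simp: B_def)
  have sq_le: "(u n)\<^sup>2 \<le> B * u n" for n
    using le nonneg by (simp add: power2_eq_square mult_right_mono)
  have sq: "(\<lambda>n. (u n)\<^sup>2) summable_on UNIV"
    by (rule summable_on_comparison_test[OF summable_on_cmult_right[OF u, of B]])
       (use sq_le in auto)
  show "(\<lambda>n. \<bar>u n\<bar> ^ 4) summable_on UNIV"
  proof (rule summable_on_comparison_test[OF summable_on_cmult_right[OF sq, of "B\<^sup>2"]])
    fix n
    have "(u n)\<^sup>2 * (u n)\<^sup>2 \<le> B\<^sup>2 * (u n)\<^sup>2"
      using le nonneg by (intro mult_right_mono power_mono) auto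
    then show "\<bar>u n\<bar> ^ 4 \<le> B\<^sup>2 * (u n)\<^sup>2"
      using nonneg[of n] by (simp flip: power_add)
  qed auto
  define K where "K k = J \<alpha> (nat \<bar>k\<bar>)" for k :: int
  have K: "K summable_on UNIV"
    by (rule summable_on_int_halves[OF J_summable[OF \<alpha>] J_summable[OF \<alpha>]]) (auto simp: K_def)
  have Kn: "((\<lambda>m. K (n - m)) has_sum infsum K UNIV) UNIV" for n
    using has_sum_infsum[OF K]
    by (subst has_sum_reindex_bij_witness[of _ "\<lambda>k. n - k" "\<lambda>m. n - m" UNIV K]) auto
  have 1: "(\<lambda>(n, m). (u n)\<^sup>2 * K (n - m)) summable_on UNIV"
  proof -
    have "(\<lambda>(n, m). (u n)\<^sup>2 * K (n - m)) summable_on Sigma UNIV (\<lambda>_. UNIV)"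
    proof (rule summable_on_SigmaI)
      show "((\<lambda>m. case (n, m) of (n, m) \<Rightarrow> (u n)\<^sup>2 * K (n - m)) has_sum (u n)\<^sup>2 * infsum K UNIV) UNIV" for n
        using has_sum_cmult_right[OF Kn[of n], of "(u n)\<^sup>2"] by simp
      show "(\<lambda>n. (u n)\<^sup>2 * infsum K UNIV) summable_on UNIV"
        by (rule summable_on_cmult_left[OF sq])
    qed (auto simp: K_def J_nonneg)
    then show ?thesis by simp
  qed
  have 2: "(\<lambda>(n, m). (u m)\<^sup>2 * K (n - m)) summable_on UNIV"
    by (subst summable_on_reindex_bij_witness[of _ "\<lambda>(m, n). (n, m)" "\<lambda>(n, m). (m, n)" UNIV
          "\<lambda>(n, m). (u n)\<^sup>2 * K (n - m)"])
       (use 1 in \<open>auto simp: K_def abs_minus_commute\<close>)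
  have 3: "(\<lambda>p. 2 * ((\<lambda>(n, m). (u n)\<^sup>2 * K (n - m)) p + (\<lambda>(n, m). (u m)\<^sup>2 * K (n - m)) p))
      summable_on {(n, m). n \<noteq> m}"
    by (rule summable_on_subset_banach[OF summable_on_cmult_right[OF summable_on_add[OF 1 2]]]) auto
  show "(\<lambda>(n, m). \<bar>u n - u m\<bar>\<^sup>2 / real_of_int \<bar>n - m\<bar> powr (1 + \<alpha>)) summable_on {(n, m). n \<noteq> m}"
  proof (rule summable_on_comparison_test[OF 3], safe)
    fix n m :: int
    have "(u n - u m)\<^sup>2 \<le> 2 * ((u n)\<^sup>2 + (u m)\<^sup>2)"
      using zero_le_power2[of "u n + u m"] by (simp add: power2_eq_square algebra_simps)
    then have "(u n - u m)\<^sup>2 * K (n - m) \<le> 2 * ((u n)\<^sup>2 + (u m)\<^sup>2) * K (n - m)"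
      by (rule mult_right_mono) (simp add: K_def J_nonneg)
    moreover have "K (n - m) = 1 / real_of_int \<bar>n - m\<bar> powr (1 + \<alpha>)"
      unfolding K_def J_def powr_minus_divide by simp
    ultimately show "\<bar>u n - u m\<bar>\<^sup>2 / real_of_int \<bar>n - m\<bar> powr (1 + \<alpha>)
        \<le> 2 * ((u n)\<^sup>2 * K (n - m) + (u m)\<^sup>2 * K (n - m))"
      by (simp add: algebra_simps)
  qed auto
qed

lemma qmode_energy_summable:
  assumes "0 < \<alpha>" "0 < \<epsilon>" "0 < \<omega>"
  defines "u \<equiv> qmode \<alpha> \<epsilon> \<omega>"
  shows "(\<lambda>n. \<bar>u n\<bar> ^ 4) summable_on UNIV"
    and "(\<lambda>(n, m). \<bar>u n - u m\<bar>\<^sup>2 / real_of_int \<bar>n - m\<bar> powr (1 + \<alpha>)) summable_on {(n, m). n \<noteq> m}"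
  unfolding u_def
  using energy_summable[OF assms(1) qmode_summable[OF assms(1-3)]] qseq_nonneg[OF assms(1-3)]
  by (auto simp: qmode_def)

lemma gmode_energy_summable:
  assumes "0 < \<alpha>" "0 < \<epsilon>" "0 < \<omega>"
  defines "u \<equiv> gmode \<alpha> \<epsilon> \<omega>"
  shows "(\<lambda>n. \<bar>u n\<bar> ^ 4) summable_on UNIV"
    and "(\<lambda>(n, m). \<bar>u n - u m\<bar>\<^sup>2 / real_of_int \<bar>n - m\<bar> powr (1 + \<alpha>)) summable_on {(n, m). n \<noteq> m}"
  unfolding u_def
  using energy_summable[OF assms(1) gmode_summable[OF assms(1-3)]] gseq_nonneg[OF assms(1-3)]
  by (auto simp: gmode_def)

end

theory Submission
  imports Defs "HOL-Real_Asymp.Real_Asymp"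
begin

text \<open>
  For large frequency each mode is concentrated on its central sites (one for the on-site,
  two for the inter-site mode): the recursion gives
  \<open>\<omega> x\<^sub>n \<le> 2 \<epsilon> (\<Sum>m<n. J\<^sub>n\<^sub>-\<^sub>m x\<^sub>m)\<close>, and summing over \<open>n \<ge> 1\<close> shows that the tail has total
  mass \<open>O(x\<^sub>0 / \<omega>)\<close>. The coupling part of the energy is at most a constant times the square of
  the total mass, hence \<open>O(\<omega>)\<close>, so the quartic term at the \<open>k\<close> central sites, each of height
  \<open>x\<^sub>0 = \<surd>(\<omega> + O(1))\<close>, dominates and the energy divided by \<open>\<omega>\<^sup>2\<close> tends to \<open>- k / 4\<close>.
  The constants of order \<open>\<epsilon>\<^sup>2\<close> do not affect the ratios.
\<close>

section \<open>Bounds for the coupling and quartic parts of the energy\<close>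

lemma sum_J_reindex_le:
  assumes "0 < \<alpha>" "finite A" "inj_on h A"
  shows "(\<Sum>m\<in>A. J \<alpha> (h m)) \<le> zeta (1 + \<alpha>)"
  using sum_J_le[OF assms(1), of "h ` A"] assms(2,3) by (simp add: sum.reindex o_def)

text \<open>On either side of \<open>n\<close> the distance to \<open>n\<close> is injective in
  \<open>m\<close>, so each side contributes at most one full series of the coefficients
  \<open>J\<close>.\<close>

lemma sum_J_abs_diff_le:
  fixes n :: int
  assumes "0 < \<alpha>" "finite A"
  shows "(\<Sum>m\<in>A. J \<alpha> (nat \<bar>n - m\<bar>)) \<le> 2 * zeta (1 + \<alpha>)"
proof -
  have "(\<Sum>m\<in>A. J \<alpha> (nat \<bar>n - m\<bar>))
      = (\<Sum>m\<in>A \<inter> {m. m \<le> n}. J \<alpha> (nat \<bar>n - m\<bar>)) + (\<Sum>m\<in>A - {m. m \<le> n}. J \<alpha> (nat \<bar>n - m\<bar>))"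
    using assms(2) by (rule sum.Int_Diff)
  also have "\<dots> \<le> zeta (1 + \<alpha>) + zeta (1 + \<alpha>)"
    using assms by (intro add_mono sum_J_reindex_le) (auto simp: inj_on_def)
  finally show ?thesis by simp
qed

lemma sum_power2_le_power2_sum:
  fixes u :: "'a \<Rightarrow> real"
  assumes "finite A" "\<And>n. n \<in> A \<Longrightarrow> 0 \<le> u n"
  shows "(\<Sum>n\<in>A. (u n)\<^sup>2) \<le> (\<Sum>n\<in>A. u n)\<^sup>2"
proof -
  have "(\<Sum>n\<in>A. (u n)\<^sup>2) \<le> (\<Sum>n\<in>A. (\<Sum>m\<in>A. u m) * u n)"
    unfolding power2_eq_square
    using assms by (intro sum_mono mult_right_mono member_le_sum) auto
  then show ?thesis
    by (simp add: power2_eq_square sum_distrib_left)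
qed

text \<open>The bound is uniform in \<open>P\<close>, so it passes to the infinite coupling sum.
  Nonnegativity gives \<open>(u n - u m)\<^sup>2 \<le> (u n)\<^sup>2 + (u m)\<^sup>2\<close>. Each
  square then meets a row sum of the kernel, at most twice zeta, and the sum of squares is at most
  the square of the total mass.\<close>

lemma coupling_finite_sum_le:
  fixes u :: "int \<Rightarrow> real"
  assumes "0 < \<alpha>" "\<And>n. 0 \<le> u n" "finite P"
    and B: "\<And>A. finite A \<Longrightarrow> sum u A \<le> B"
  shows "(\<Sum>(n, m)\<in>P. \<bar>u n - u m\<bar>\<^sup>2 / real_of_int \<bar>n - m\<bar> powr (1 + \<alpha>)) \<le> 4 * zeta (1 + \<alpha>) * B\<^sup>2"
proof -
  \<comment> \<open>Enlarging \<open>P\<close> to the square \<open>A \<times> A\<close> turns the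
    sum over pairs into an iterated sum with full rows.\<close>
  define A where "A = fst ` P \<union> snd ` P"
  have A: "finite A" "P \<subseteq> A \<times> A"
    using assms(3) by (auto simp: A_def image_iff) force+
  let ?K = "\<lambda>n m :: int. J \<alpha> (nat \<bar>n - m\<bar>)"
  \<comment> \<open>This also covers \<open>n = m\<close>: both sides are then 0, because division
    by 0 gives 0 and \<open>J \<alpha> 0 = 0\<close>. Diagonal pairs in \<open>A \<times> A\<close>
    are therefore harmless.\<close>
  have K: "1 / real_of_int \<bar>n - m\<bar> powr (1 + \<alpha>) = ?K n m" for n m
    unfolding J_def powr_minus_divide by simp
  have "(\<Sum>(n, m)\<in>P. \<bar>u n - u m\<bar>\<^sup>2 / real_of_int \<bar>n - m\<bar> powr (1 + \<alpha>))
      \<le> (\<Sum>(n, m)\<in>P. ((u n)\<^sup>2 + (u m)\<^sup>2) * ?K n m)"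
  proof (rule sum_mono, safe)
    fix n m
    have "\<bar>u n - u m\<bar>\<^sup>2 \<le> (u n)\<^sup>2 + (u m)\<^sup>2"
      using assms(2)[of n] assms(2)[of m] by (simp add: power2_diff)
    then have "\<bar>u n - u m\<bar>\<^sup>2 * ?K n m \<le> ((u n)\<^sup>2 + (u m)\<^sup>2) * ?K n m"
      by (rule mult_right_mono) (rule J_nonneg)
    then show "\<bar>u n - u m\<bar>\<^sup>2 / real_of_int \<bar>n - m\<bar> powr (1 + \<alpha>) \<le> ((u n)\<^sup>2 + (u m)\<^sup>2) * ?K n m"
      by (simp flip: K)
  qed
  also have "\<dots> \<le> (\<Sum>(n, m)\<in>A \<times> A. ((u n)\<^sup>2 + (u m)\<^sup>2) * ?K n m)"
    using A by (intro sum_mono2) (auto intro: mult_nonneg_nonneg J_nonneg)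
  also have "\<dots> = (\<Sum>n\<in>A. \<Sum>m\<in>A. (u n)\<^sup>2 * ?K n m) + (\<Sum>n\<in>A. \<Sum>m\<in>A. (u m)\<^sup>2 * ?K n m)"
    by (simp add: sum.distrib ring_distribs flip: sum.cartesian_product)
  also have "(\<Sum>n\<in>A. \<Sum>m\<in>A. (u m)\<^sup>2 * ?K n m) = (\<Sum>n\<in>A. \<Sum>m\<in>A. (u n)\<^sup>2 * ?K n m)"
    by (subst sum.swap) (simp add: abs_minus_commute)
  also have "(\<Sum>n\<in>A. \<Sum>m\<in>A. (u n)\<^sup>2 * ?K n m) \<le> (\<Sum>n\<in>A. (u n)\<^sup>2 * (2 * zeta (1 + \<alpha>)))"
    unfolding sum_distrib_left[symmetric]
    using assms(1) A by (intro sum_mono mult_left_mono sum_J_abs_diff_le) auto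
  also have "\<dots> = 2 * zeta (1 + \<alpha>) * (\<Sum>n\<in>A. (u n)\<^sup>2)"
    by (simp add: sum_distrib_left mult_ac)
  also have "\<dots> \<le> 2 * zeta (1 + \<alpha>) * B\<^sup>2"
  proof (intro mult_left_mono)
    have "(\<Sum>n\<in>A. (u n)\<^sup>2) \<le> (sum u A)\<^sup>2"
      using A assms(2) by (intro sum_power2_le_power2_sum) auto
    also have "\<dots> \<le> B\<^sup>2"
      using A assms(2) B by (intro power_mono sum_nonneg) auto
    finally show "(\<Sum>n\<in>A. (u n)\<^sup>2) \<le> B\<^sup>2" .
  qed (use J_le_zeta[of \<alpha> 0] assms(1) in simp)
  finally show ?thesis by simp
qed

text \<open>The sites in \<open>S\<close> carry the main quartic term and all other sites have total
  mass at most \<open>R\<close>. The two errors come from the coupling energy, controlled by the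
  total mass \<open>card S * c + R\<close>, and from the quartic sum outside
  \<open>S\<close>.\<close>

lemma energy_concentrated:
  fixes u :: "int \<Rightarrow> real" and c R :: real
  assumes \<alpha>: "0 < \<alpha>" and \<epsilon>: "0 < \<epsilon>" and nonneg: "\<And>n. 0 \<le> u n"
    and S: "finite S" "\<And>n. n \<in> S \<Longrightarrow> u n = c"
    and tail: "\<And>A. finite A \<Longrightarrow> A \<inter> S = {} \<Longrightarrow> sum u A \<le> R"
  shows "\<bar>energy \<alpha> \<epsilon> u + card S / 4 * c ^ 4\<bar>
           \<le> \<epsilon> * zeta (1 + \<alpha>) * (card S * c + R)\<^sup>2 + R ^ 4 / 4"
proof -
  have total: "sum u A \<le> card S * c + R" if "finite A" for A
  proof -
    have "sum u A = sum u (A \<inter> S) + sum u (A - S)"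
      using that by (rule sum.Int_Diff)
    also have "\<dots> \<le> sum u S + R"
      using S nonneg that by (intro add_mono sum_mono2 tail) auto
    also have "sum u S = card S * c"
      using S by simp
    finally show ?thesis .
  qed
  have "u summable_on UNIV"
    using total nonneg by (intro nonneg_bdd_above_summable_on bdd_aboveI[of _ "card S * c + R"]) auto
  note summable = energy_summable[OF \<alpha> this nonneg]
  let ?C = "infsum (\<lambda>(n, m). \<bar>u n - u m\<bar>\<^sup>2 / real_of_int \<bar>n - m\<bar> powr (1 + \<alpha>)) {(n, m). n \<noteq> m}"
  have "?C \<le> 4 * zeta (1 + \<alpha>) * (card S * c + R)\<^sup>2"
    using summable(2) by (rule infsum_le_finite_sums) (use coupling_finite_sum_le \<alpha> nonneg total in auto)
  then have C: "\<epsilon> / 4 * ?C \<le> \<epsilon> * zeta (1 + \<alpha>) * (card S * c + R)\<^sup>2"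
    using mult_left_mono[of ?C _ "\<epsilon> / 4"] \<epsilon> by simp
  have C0: "0 \<le> \<epsilon> / 4 * ?C"
    using \<epsilon> by (intro mult_nonneg_nonneg infsum_nonneg) auto
  have S4: "(\<Sum>n\<in>S. \<bar>u n\<bar> ^ 4) = card S * c ^ 4"
    using S by simp
  have R: "0 \<le> R"
    using tail[of "{}"] by simp
  have "(\<Sum>n\<in>A. \<bar>u n\<bar> ^ 4) \<le> card S * c ^ 4 + R ^ 4" if "finite A" for A
  proof -
    \<comment> \<open>A single tail value is at most \<open>R\<close>, so three of the four factors
      in its fourth power can be replaced by \<open>R\<close>; the remaining factor is summed with
      the tail bound.\<close>
    have le: "u n \<le> R" if "n \<in> A - S" for n
      using tail[of "{n}"] that by auto
    have "(\<Sum>n\<in>A. \<bar>u n\<bar> ^ 4) = (\<Sum>n\<in>A \<inter> S. \<bar>u n\<bar> ^ 4) + (\<Sum>n\<in>A - S. \<bar>u n\<bar> ^ 4)"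
      using that by (rule sum.Int_Diff)
    also have "\<dots> \<le> (\<Sum>n\<in>S. \<bar>u n\<bar> ^ 4) + (\<Sum>n\<in>A - S. R ^ 3 * u n)"
    proof (intro add_mono sum_mono2 sum_mono)
      fix n assume "n \<in> A - S"
      then have "u n ^ 3 * u n \<le> R ^ 3 * u n"
        using le nonneg by (intro mult_right_mono power_mono) auto
      then show "\<bar>u n\<bar> ^ 4 \<le> R ^ 3 * u n"
        using nonneg[of n] by (simp add: eval_nat_numeral mult_ac)
    qed (use S in auto)
    also have "(\<Sum>n\<in>A - S. R ^ 3 * u n) \<le> R ^ 3 * R"
      unfolding sum_distrib_left[symmetric]
      using that R by (intro mult_left_mono tail) auto
    also have "R ^ 3 * R = R ^ 4"
      by (simp add: eval_nat_numeral)
    finally show ?thesis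
      by (simp only: S4)
  qed
  then have Q: "(\<Sum>\<^sub>\<infinity>n. \<bar>u n\<bar> ^ 4) \<le> card S * c ^ 4 + R ^ 4"
    using summable(1) by (intro infsum_le_finite_sums) auto
  have Q0: "card S * c ^ 4 \<le> (\<Sum>\<^sub>\<infinity>n. \<bar>u n\<bar> ^ 4)"
    using finite_sum_le_infsum[OF summable(1) S(1)] by (simp only: S4) simp
  \<comment> \<open>The quantity is the coupling energy minus a quarter of the quartic excess over
    \<open>card S * c ^ 4\<close>. Both are nonnegative and bounded above, so the sum of their
    bounds controls the absolute value.\<close>
  show ?thesis
    unfolding energy_def using C C0 Q Q0 by linarith
qed

section \<open>Tail mass of a causal recursion, and energies of folded sequences\<close>

lemma tail_sum_bound:
  fixes x :: "nat \<Rightarrow> real"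
  assumes "0 < \<alpha>" "0 < \<epsilon>" "\<And>n. 0 \<le> x n" "2 * \<epsilon> * zeta (1 + \<alpha>) < \<omega>"
    and step: "\<And>n. 1 \<le> n \<Longrightarrow> \<omega> * x n \<le> 2 * \<epsilon> * (\<Sum>m<n. J \<alpha> (n - m) * x m)"
  shows "(\<Sum>n\<in>{1..N}. x n) \<le> 2 * \<epsilon> * zeta (1 + \<alpha>) * x 0 / (\<omega> - 2 * \<epsilon> * zeta (1 + \<alpha>))"
proof -
  have "(\<omega> - 2 * \<epsilon> * zeta (1 + \<alpha>)) * (\<Sum>n\<in>{1..N}. x n) \<le> 2 * \<epsilon> * zeta (1 + \<alpha>) * x 0"
  \<comment> \<open>The summand \<open>m = 0\<close> is split off as the source term
    \<open>b\<close>. The columns of the remaining kernel sum to at most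
    \<open>2 * \<epsilon> * zeta (1 + \<alpha>)\<close>, which is subtracted from \<omega> to give
    the factor on the left.\<close>
  proof (rule causal_partial_sum_bound[where D = \<omega> and b = "\<lambda>n. 2 * \<epsilon> * x 0 * J \<alpha> n"
        and K = "\<lambda>n m. 2 * \<epsilon> * J \<alpha> (n - m)"])
    fix n assume "n \<in> {1..N}"
    then have "\<omega> * x n \<le> 2 * \<epsilon> * (\<Sum>m<n. J \<alpha> (n - m) * x m)" and n: "{..<n} = insert 0 {1..<n}"
      by (auto intro: step)
    then show "\<omega> * x n \<le> 2 * \<epsilon> * x 0 * J \<alpha> n + (\<Sum>m\<in>{1..<n}. 2 * \<epsilon> * J \<alpha> (n - m) * x m)"
      by (simp add: n sum_distrib_left ring_distribs mult_ac)
  next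
    fix m
    have "(\<Sum>n\<in>{m<..N}. 2 * \<epsilon> * J \<alpha> (n - m)) \<le> 2 * \<epsilon> * zeta (1 + \<alpha>)"
      unfolding sum_distrib_left[symmetric]
      using assms(1,2) by (intro mult_left_mono sum_J_reindex_le) (auto simp: inj_on_def)
    then show "(\<Sum>n\<in>{m<..N}. 2 * \<epsilon> * J \<alpha> (n - m)) \<le> \<omega> - (\<omega> - 2 * \<epsilon> * zeta (1 + \<alpha>))"
      by simp
  next
    have "2 * \<epsilon> * x 0 * sum (J \<alpha>) {1..N} \<le> 2 * \<epsilon> * x 0 * zeta (1 + \<alpha>)"
      using assms by (intro mult_left_mono sum_J_le) auto
    then show "(\<Sum>n\<in>{1..N}. 2 * \<epsilon> * x 0 * J \<alpha> n) \<le> 2 * \<epsilon> * zeta (1 + \<alpha>) * x 0"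
      by (simp add: sum_distrib_left mult_ac)
  qed (rule assms(3))
  then show ?thesis
    using assms(4) by (simp add: field_simps)
qed

text \<open>Treats both modes at once: \<open>r\<close> folds the integers onto the naturals,
  injectively on each half-line, and its fibre over 0 is the set of central sites. The tail is thus
  counted at most twice, whence \<open>2 * T\<close>.\<close>

lemma energy_folded_bound:
  fixes x :: "nat \<Rightarrow> real" and r :: "int \<Rightarrow> nat"
  assumes \<alpha>: "0 < \<alpha>" and \<epsilon>: "0 < \<epsilon>" and x: "\<And>n. 0 \<le> x n"
    and \<omega>: "2 * \<epsilon> * zeta (1 + \<alpha>) < \<omega>"
    and step: "\<And>n. 1 \<le> n \<Longrightarrow> \<omega> * x n \<le> 2 * \<epsilon> * (\<Sum>m<n. J \<alpha> (n - m) * x m)"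
    and r: "inj_on r {1..}" "inj_on r {..0}" "finite (r -` {0})"
  defines "k \<equiv> card (r -` {0})"
    and "T \<equiv> 2 * \<epsilon> * zeta (1 + \<alpha>) * x 0 / (\<omega> - 2 * \<epsilon> * zeta (1 + \<alpha>))"
  shows "\<bar>energy \<alpha> \<epsilon> (\<lambda>n. x (r n)) + k / 4 * x 0 ^ 4\<bar>
           \<le> \<epsilon> * zeta (1 + \<alpha>) * (k * x 0 + 2 * T)\<^sup>2 + (2 * T) ^ 4 / 4"
  unfolding k_def
proof (rule energy_concentrated[OF \<alpha> \<epsilon>])
  \<comment> \<open>On a set avoiding the central fibre all indices \<open>r n\<close> are at least
    1, and injectivity makes the sum a subsum of the tail of \<open>x\<close>.\<close>
  have half: "(\<Sum>n\<in>A. x (r n)) \<le> T" if A: "finite A" "A \<inter> r -` {0} = {}" "inj_on r A" for A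
  proof -
    obtain N where N: "r ` A \<subseteq> {..N}"
      using A(1) finite_nat_iff_bounded_le by blast
    have range: "r ` A \<subseteq> {1..N}"
    proof
      fix m assume m: "m \<in> r ` A"
      then have "m \<noteq> 0"
        using A(2) by auto
      moreover have "m \<le> N"
        using N m by (metis atMost_iff subsetD)
      ultimately show "m \<in> {1..N}" by simp
    qed
    have "(\<Sum>n\<in>A. x (r n)) = sum x (r ` A)"
      using A(3) by (simp add: sum.reindex)
    also have "\<dots> \<le> sum x {1..N}"
      using range x by (intro sum_mono2) auto
    also have "\<dots> \<le> T"
      unfolding T_def by (rule tail_sum_bound[OF \<alpha> \<epsilon> x \<omega> step])
    finally show ?thesis .
  qed
  fix A :: "int set" assume A: "finite A" "A \<inter> r -` {0} = {}"
  have "(\<Sum>n\<in>A. x (r n)) = (\<Sum>n\<in>A \<inter> {1..}. x (r n)) + (\<Sum>n\<in>A - {1..}. x (r n))"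
    using A(1) by (rule sum.Int_Diff)
  also have "\<dots> \<le> T + T"
    using A by (intro add_mono half inj_on_subset[OF r(1)] inj_on_subset[OF r(2)]) auto
  finally show "(\<Sum>n\<in>A. x (r n)) \<le> 2 * T" by simp
qed (use x r(3) in auto)

text \<open>With \<open>x \<omega> 0 = sqrt (\<omega> + a)\<close> the tail mass is of order
  \<omega> to the power -1/2, so the error in the preceding bound is of order \<omega> and
  disappears after division by \<open>\<omega>\<^sup>2\<close>. Only the fourth powers at the
  central sites survive.\<close>

lemma energy_folded_tendsto:
  fixes x :: "real \<Rightarrow> nat \<Rightarrow> real" and r :: "int \<Rightarrow> nat"
  assumes \<alpha>: "0 < \<alpha>" and \<epsilon>: "0 < \<epsilon>" and x: "\<And>\<omega> n. 0 < \<omega> \<Longrightarrow> 0 \<le> x \<omega> n"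
    and x0: "\<And>\<omega>. x \<omega> 0 = sqrt (\<omega> + a)"
    and step: "\<And>\<omega> n. 0 < \<omega> \<Longrightarrow> 1 \<le> n \<Longrightarrow> \<omega> * x \<omega> n \<le> 2 * \<epsilon> * (\<Sum>m<n. J \<alpha> (n - m) * x \<omega> m)"
    and r: "inj_on r {1..}" "inj_on r {..0}" "finite (r -` {0})"
  shows "((\<lambda>\<omega>. energy \<alpha> \<epsilon> (\<lambda>n. x \<omega> (r n)) / \<omega>\<^sup>2) \<longlongrightarrow> - real (card (r -` {0})) / 4) at_top"
proof -
  define Z where "Z = 2 * \<epsilon> * zeta (1 + \<alpha>)"
  define k where "k = real (card (r -` {0}))"
  define T where "T \<omega> = Z * sqrt (\<omega> + a) / (\<omega> - Z)" for \<omega>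
  define E where "E \<omega> = energy \<alpha> \<epsilon> (\<lambda>n. x \<omega> (r n))" for \<omega>
  have Z: "0 \<le> Z"
    using J_le_zeta[OF \<alpha>, of 0] \<epsilon> by (simp add: Z_def)
  \<comment> \<open>Since \<open>Z\<close> is nonnegative, \<open>Z < \<omega>\<close> also supplies
    the positivity of \<omega> required by the hypotheses on \<open>x\<close>.\<close>
  have bound: "\<bar>E \<omega> + k / 4 * sqrt (\<omega> + a) ^ 4\<bar>
      \<le> Z / 2 * (k * sqrt (\<omega> + a) + 2 * T \<omega>)\<^sup>2 + (2 * T \<omega>) ^ 4 / 4" if "Z < \<omega>" for \<omega>
    using energy_folded_bound[OF \<alpha> \<epsilon> x _ step r, of \<omega>] that Z
    by (simp add: E_def k_def T_def Z_def x0)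
  have "((\<lambda>\<omega>. (E \<omega> + k / 4 * sqrt (\<omega> + a) ^ 4) / \<omega>\<^sup>2) \<longlongrightarrow> 0) at_top"
  proof (rule Lim_null_comparison)
    show "\<forall>\<^sub>F \<omega> in at_top. norm ((E \<omega> + k / 4 * sqrt (\<omega> + a) ^ 4) / \<omega>\<^sup>2)
        \<le> (Z / 2 * (k * sqrt (\<omega> + a) + 2 * T \<omega>)\<^sup>2 + (2 * T \<omega>) ^ 4 / 4) / \<omega>\<^sup>2"
      using eventually_gt_at_top[of Z]
      by eventually_elim (use bound in \<open>auto simp: abs_divide intro: divide_right_mono\<close>)
    have "((\<lambda>\<omega>. sqrt (\<omega> + a) / \<omega>) \<longlongrightarrow> 0) at_top"
      by real_asymp
    moreover have "((\<lambda>\<omega>. T \<omega> / \<omega>) \<longlongrightarrow> 0) at_top" "(T \<longlongrightarrow> 0) at_top"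
      unfolding T_def by real_asymp+
    \<comment> \<open>The division by \<open>\<omega>\<^sup>2\<close> is distributed over factors
      that each tend to 0; the coefficient 4 arises from
      \<open>(2 * T \<omega>) ^ 4 / 4 = 4 * T \<omega> ^ 4\<close>.\<close>
    ultimately have "((\<lambda>\<omega>. Z / 2 * (k * (sqrt (\<omega> + a) / \<omega>) + 2 * (T \<omega> / \<omega>))\<^sup>2
        + 4 * (T \<omega> / \<omega>)\<^sup>2 * (T \<omega>)\<^sup>2) \<longlongrightarrow> Z / 2 * (k * 0 + 2 * 0)\<^sup>2 + 4 * 0\<^sup>2 * 0\<^sup>2) at_top"
      by (intro tendsto_intros)
    moreover have "Z / 2 * (k * (s / w) + 2 * (t / w))\<^sup>2 + 4 * (t / w)\<^sup>2 * t\<^sup>2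
        = (Z / 2 * (k * s + 2 * t)\<^sup>2 + (2 * t) ^ 4 / 4) / w\<^sup>2" for s t w
    proof -
      have "k * (s / w) + 2 * (t / w) = (k * s + 2 * t) / w"
        by (simp add: add_divide_distrib)
      then have "(k * (s / w) + 2 * (t / w))\<^sup>2 = (k * s + 2 * t)\<^sup>2 / w\<^sup>2"
        by (simp only: power_divide)
      moreover have "4 * (t / w)\<^sup>2 * t\<^sup>2 = (2 * t) ^ 4 / 4 / w\<^sup>2"
        by (simp add: power_divide power_mult_distrib flip: power_add)
      ultimately show ?thesis
        by (simp only: add_divide_distrib times_divide_eq_right)
    qed
    ultimately show "((\<lambda>\<omega>. (Z / 2 * (k * sqrt (\<omega> + a) + 2 * T \<omega>)\<^sup>2 + (2 * T \<omega>) ^ 4 / 4) / \<omega>\<^sup>2) \<longlongrightarrow> 0) at_top"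
      by simp
  qed
  moreover have "((\<lambda>\<omega>. k / 4 * (sqrt (\<omega> + a) ^ 4 / \<omega>\<^sup>2)) \<longlongrightarrow> k / 4 * 1) at_top"
    by (rule tendsto_mult_left) real_asymp
  ultimately have "((\<lambda>\<omega>. (E \<omega> + k / 4 * sqrt (\<omega> + a) ^ 4) / \<omega>\<^sup>2
      - k / 4 * (sqrt (\<omega> + a) ^ 4 / \<omega>\<^sup>2)) \<longlongrightarrow> 0 - k / 4 * 1) at_top"
    by (rule tendsto_diff)
  then show ?thesis
    by (simp add: E_def k_def diff_divide_distrib add_divide_distrib)
qed

section \<open>Both recursions in the common causal form\<close>

lemma qseq_step:
  assumes "0 < \<alpha>" "0 < \<epsilon>" "0 < \<omega>" "1 \<le> n"
  shows "\<omega> * qseq \<alpha> \<epsilon> \<omega> n \<le> 2 * \<epsilon> * (\<Sum>m<n. J \<alpha> (n - m) * qseq \<alpha> \<epsilon> \<omega> m)"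
proof -
  let ?q = "qseq \<alpha> \<epsilon> \<omega>" and ?D = "\<epsilon> * (2 * zeta (1 + \<alpha>) - J \<alpha> (2 * n)) + \<omega>"
  note q = qseq_nonneg[OF assms(1-3)]
  have n: "{..<n} = insert 0 {1..<n}"
    using assms(4) by auto
  \<comment> \<open>The part of the denominator \<open>?D\<close> beyond \<omega> is nonnegative, so
    replacing \<open>?D\<close> by \<omega> only decreases the left side.\<close>
  have "J \<alpha> (2 * n) \<le> 2 * zeta (1 + \<alpha>)"
    using J_le_zeta[OF assms(1), of "2 * n"] J_nonneg[of \<alpha> "2 * n"] by linarith
  then have "\<omega> * ?q n \<le> ?D * ?q n"
    using assms by (intro mult_right_mono q) auto
  also have "\<dots> = \<epsilon> * (J \<alpha> n * ?q 0 + (\<Sum>m\<in>{1..<n}. (J \<alpha> (n - m) + J \<alpha> (n + m)) * ?q m))"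
    using denom_pos[OF assms(1-3), of "2 * n"] assms(4)
    by (subst (1) qseq.simps) (simp add: field_simps)
  \<comment> \<open>The reflected coupling at \<open>n + m\<close> is at most the direct one at
    \<open>n - m\<close>, as \<open>J\<close> decreases on positive indices. Doubling the
    \<open>?q 0\<close> term as well lets it join the sum as its \<open>m = 0\<close>
    summand.\<close>
  also have "\<dots> \<le> \<epsilon> * (2 * (J \<alpha> n * ?q 0) + (\<Sum>m\<in>{1..<n}. (2 * J \<alpha> (n - m)) * ?q m))"
  proof (intro mult_left_mono add_mono sum_mono mult_right_mono q)
    fix m assume "m \<in> {1..<n}"
    then show "J \<alpha> (n - m) + J \<alpha> (n + m) \<le> 2 * J \<alpha> (n - m)"
      using J_antimono[OF assms(1), of "n - m" "n + m"] by auto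
  qed (use assms q[of 0] J_nonneg[of \<alpha> n] in auto)
  also have "\<dots> = 2 * \<epsilon> * (\<Sum>m<n. J \<alpha> (n - m) * ?q m)"
    by (simp add: n sum_distrib_left ring_distribs mult_ac)
  finally show ?thesis .
qed

text \<open>The shift by \<open>Suc\<close> moves the central value of the inter-site mode to index
  0, matching the on-site form. The distance \<open>n - m\<close> is unchanged, while the reflected
  index \<open>n + m - 1\<close> becomes \<open>Suc (n + m)\<close>.\<close>

lemma gseq_step:
  assumes "0 < \<alpha>" "0 < \<epsilon>" "0 < \<omega>" "1 \<le> n"
  shows "\<omega> * gseq \<alpha> \<epsilon> \<omega> (Suc n) \<le> 2 * \<epsilon> * (\<Sum>m<n. J \<alpha> (n - m) * gseq \<alpha> \<epsilon> \<omega> (Suc m))"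
proof -
  let ?g = "gseq \<alpha> \<epsilon> \<omega>" and ?D = "\<epsilon> * (2 * zeta (1 + \<alpha>) - J \<alpha> (2 * n + 1)) + \<omega>"
  note g = gseq_nonneg[OF assms(1-3)]
  have "J \<alpha> (2 * n + 1) \<le> 2 * zeta (1 + \<alpha>)"
    using J_le_zeta[OF assms(1), of "2 * n + 1"] J_nonneg[of \<alpha> "2 * n + 1"] by linarith
  then have "\<omega> * ?g (Suc n) \<le> ?D * ?g (Suc n)"
    using assms by (intro mult_right_mono g) auto
  also have "\<dots> = \<epsilon> * (\<Sum>m\<in>{1..<Suc n}. (J \<alpha> (Suc n - m) + J \<alpha> (Suc n + m - 1)) * ?g m)"
    using denom_pos[OF assms(1-3), of "2 * n + 1"] assms(4)
    by (subst (1) gseq.simps) (simp add: field_simps)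
  also have "\<dots> = \<epsilon> * (\<Sum>m<n. (J \<alpha> (n - m) + J \<alpha> (Suc (n + m))) * ?g (Suc m))"
    unfolding One_nat_def sum.shift_bounds_Suc_ivl by (simp add: atLeast0LessThan)
  also have "\<dots> \<le> \<epsilon> * (\<Sum>m<n. (2 * J \<alpha> (n - m)) * ?g (Suc m))"
  proof (intro mult_left_mono sum_mono mult_right_mono g)
    fix m assume "m \<in> {..<n}"
    then show "J \<alpha> (n - m) + J \<alpha> (Suc (n + m)) \<le> 2 * J \<alpha> (n - m)"
      using J_antimono[OF assms(1), of "n - m" "Suc (n + m)"] by auto
  qed (use assms in auto)
  also have "\<dots> = 2 * \<epsilon> * (\<Sum>m<n. J \<alpha> (n - m) * ?g (Suc m))"
    by (simp add: sum_distrib_left mult_ac)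
  finally show ?thesis .
qed

section \<open>Limits of the normalised energies\<close>

lemma E_A_tendsto:
  assumes "0 < \<alpha>" "0 < \<epsilon>"
  shows "((\<lambda>\<omega>. E_A \<alpha> \<epsilon> \<omega> / \<omega>\<^sup>2) \<longlongrightarrow> - 1 / 4) at_top"
proof -
  have S: "(\<lambda>n :: int. nat \<bar>n\<bar>) -` {0} = {0}"
    by auto
  have "((\<lambda>\<omega>. energy \<alpha> \<epsilon> (\<lambda>n. qseq \<alpha> \<epsilon> \<omega> (nat \<bar>n\<bar>)) / \<omega>\<^sup>2)
      \<longlongrightarrow> - real (card ((\<lambda>n :: int. nat \<bar>n\<bar>) -` {0})) / 4) at_top"
    using assms
    by (intro energy_folded_tendsto[where a = "2 * \<epsilon> * zeta (1 + \<alpha>)"] qseq_nonneg qseq_step)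
       (auto simp: inj_on_def qseq.simps[of _ _ _ 0] S)
  then show ?thesis
    by (simp add: S E_A_def qmode_def[abs_def])
qed

lemma E_B_tendsto:
  assumes "0 < \<alpha>" "0 < \<epsilon>"
  shows "((\<lambda>\<omega>. E_B \<alpha> \<epsilon> \<omega> / \<omega>\<^sup>2) \<longlongrightarrow> - 1 / 2) at_top"
proof -
  \<comment> \<open>\<open>r\<close> is the distance to the nearer of the two central sites 0 and 1;
    its fibre over 0 has two elements, which gives the limit -2/4.\<close>
  define r where "r n = (if n \<ge> 1 then nat (n - 1) else nat (- n))" for n :: int
  have S: "r -` {0} = {0, 1}"
    by (auto simp: r_def split: if_splits)
  have r: "gmode \<alpha> \<epsilon> \<omega> = (\<lambda>n. gseq \<alpha> \<epsilon> \<omega> (Suc (r n)))" for \<omega>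
    by (auto simp: gmode_def r_def fun_eq_iff intro!: arg_cong[of _ _ "gseq \<alpha> \<epsilon> \<omega>"])
  have "((\<lambda>\<omega>. energy \<alpha> \<epsilon> (\<lambda>n. gseq \<alpha> \<epsilon> \<omega> (Suc (r n))) / \<omega>\<^sup>2) \<longlongrightarrow> - real (card (r -` {0})) / 4) at_top"
    using assms
    by (intro energy_folded_tendsto[where a = "\<epsilon> * (2 * zeta (1 + \<alpha>) - J \<alpha> 1)"] gseq_nonneg gseq_step)
       (auto simp: inj_on_def r_def gseq.simps[of _ _ _ "Suc 0"] S[unfolded r_def])
  then show ?thesis
    by (simp add: S E_B_def r)
qed

section \<open>Asymptotic equivalences under the equal-power relation\<close>

theorem corollary5p4:
  fixes \<alpha> \<epsilon> :: real
    and F :: "'i filter"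
    and \<omega>\<^sub>A \<omega>\<^sub>B :: "'i \<Rightarrow> real"
  assumes "\<alpha> > 0" and "\<epsilon> > 0"
    and "\<And>x. \<omega>\<^sub>A x > 0" and "\<And>x. \<omega>\<^sub>B x > 0"
    and "\<And>x. \<omega>\<^sub>A x = 2 * \<omega>\<^sub>B x"
    and "filterlim \<omega>\<^sub>A at_top F" and "filterlim \<omega>\<^sub>B at_top F"
  shows "((\<lambda>x. E_A \<alpha> \<epsilon> (\<omega>\<^sub>A x)) \<sim>[F]
           (\<lambda>x. - (\<omega>\<^sub>A x)\<^sup>2 / 4 - (2 * zeta (2 + 2 * \<alpha>) + (zeta (1 + \<alpha>))\<^sup>2) * \<epsilon>\<^sup>2))
    \<and> ((\<lambda>x. E_B \<alpha> \<epsilon> (\<omega>\<^sub>B x)) \<sim>[F]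
           (\<lambda>x. - (\<omega>\<^sub>B x)\<^sup>2 / 2
                - (2 * (\<Sum>\<^sub>\<infinity>n\<in>{2::nat..}. (1 / real n powr (1 + \<alpha>) + 1 / real (n - 1) powr (1 + \<alpha>))\<^sup>2)
                   + 1 / 2 * (2 * zeta (1 + \<alpha>) - 1)\<^sup>2) * \<epsilon>\<^sup>2))
    \<and> ((\<lambda>x. E_A \<alpha> \<epsilon> (\<omega>\<^sub>A x)) \<sim>[F] (\<lambda>x. 2 * E_B \<alpha> \<epsilon> (\<omega>\<^sub>B x)))
    \<and> ((\<lambda>x. E_A \<alpha> \<epsilon> (\<omega>\<^sub>A x) - E_B \<alpha> \<epsilon> (\<omega>\<^sub>B x)) \<sim>[F] (\<lambda>x. - (\<omega>\<^sub>A x)\<^sup>2 / 8))"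
proof -
  \<comment> \<open>All four equivalences reduce to a common nonzero limit after division by the
    same positive function \<open>(\<omega>\<^sub>B x)\<^sup>2\<close>.\<close>
  have equiv: "f \<sim>[F] g"
    if f: "((\<lambda>x. f x / (\<omega>\<^sub>B x)\<^sup>2) \<longlongrightarrow> c) F" and g: "((\<lambda>x. g x / (\<omega>\<^sub>B x)\<^sup>2) \<longlongrightarrow> c) F" and c: "c \<noteq> 0"
    for f g :: "'i \<Rightarrow> real" and c
  proof -
    have "(\<lambda>x. f x / (\<omega>\<^sub>B x)\<^sup>2) \<sim>[F] (\<lambda>x. g x / (\<omega>\<^sub>B x)\<^sup>2)"
      using asymp_equiv_trans[OF tendsto_imp_asymp_equiv_const[OF f c]
          asymp_equiv_symI[OF tendsto_imp_asymp_equiv_const[OF g c]]] .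
    from asymp_equiv_mult[OF this asymp_equiv_refl[of "\<lambda>x. (\<omega>\<^sub>B x)\<^sup>2"]]
    show ?thesis
      using assms(4) by (simp add: less_imp_neq[THEN not_sym])
  qed
  \<comment> \<open>The factor 4 converts the normalisation, since \<open>(\<omega>\<^sub>A
    x)\<^sup>2 = 4 * (\<omega>\<^sub>B x)\<^sup>2\<close>.\<close>
  have A: "((\<lambda>x. E_A \<alpha> \<epsilon> (\<omega>\<^sub>A x) / (\<omega>\<^sub>B x)\<^sup>2) \<longlongrightarrow> - 1) F"
    using tendsto_mult_left[OF filterlim_compose[OF E_A_tendsto[OF assms(1,2)] assms(6)], of 4]
    by (simp add: assms(5))
  have B: "((\<lambda>x. E_B \<alpha> \<epsilon> (\<omega>\<^sub>B x) / (\<omega>\<^sub>B x)\<^sup>2) \<longlongrightarrow> - 1 / 2) F"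
    by (rule filterlim_compose[OF E_B_tendsto[OF assms(1,2)] assms(7)])
  \<comment> \<open>\<open>K\<close> stands for an arbitrary constant, in particular for the
    corrections of order \<open>\<epsilon>\<^sup>2\<close>, and vanishes in the limit.\<close>
  have rhs: "((\<lambda>x. (- (\<omega>\<^sub>B x)\<^sup>2 * b - K) / (\<omega>\<^sub>B x)\<^sup>2) \<longlongrightarrow> - b) F" for b K
    by (rule filterlim_compose[OF _ assms(7), of "\<lambda>\<omega>. (- \<omega>\<^sup>2 * b - K) / \<omega>\<^sup>2"]) real_asymp
  have 1: "((\<lambda>x. (- (\<omega>\<^sub>A x)\<^sup>2 / 4 - K) / (\<omega>\<^sub>B x)\<^sup>2) \<longlongrightarrow> - 1) F" for K
    using rhs[of 1 K] by (simp add: assms(5))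
  have 2: "((\<lambda>x. (- (\<omega>\<^sub>B x)\<^sup>2 / 2 - K) / (\<omega>\<^sub>B x)\<^sup>2) \<longlongrightarrow> - 1 / 2) F" for K
    using rhs[of "1 / 2" K] by simp
  have 3: "((\<lambda>x. (2 * E_B \<alpha> \<epsilon> (\<omega>\<^sub>B x)) / (\<omega>\<^sub>B x)\<^sup>2) \<longlongrightarrow> - 1) F"
    using tendsto_mult_left[OF B, of 2] by simp
  \<comment> \<open>The leading terms do not cancel: the limits -1 and -1/2 differ, so the barrier
    is again of quadratic order.\<close>
  have 4: "((\<lambda>x. (E_A \<alpha> \<epsilon> (\<omega>\<^sub>A x) - E_B \<alpha> \<epsilon> (\<omega>\<^sub>B x)) / (\<omega>\<^sub>B x)\<^sup>2) \<longlongrightarrow> - 1 / 2) F"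
    using tendsto_diff[OF A B] by (simp add: diff_divide_distrib)
  have 5: "((\<lambda>x. (- (\<omega>\<^sub>A x)\<^sup>2 / 8) / (\<omega>\<^sub>B x)\<^sup>2) \<longlongrightarrow> - 1 / 2) F"
    using rhs[of "1 / 2" 0] by (simp add: assms(5))
  show ?thesis
    by (intro conjI equiv[OF A 1] equiv[OF B 2] equiv[OF A 3] equiv[OF 4 5]) auto
qed

end
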